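(* The general deduction Frege system $d\mathscr{F}$ and the general disjunction Frege system $o\mathscr{F}$ (both built over the same classical Frege system $\mathscr{F}$) linearly simulate one another: any $d\mathscr{F}$ proof of a formula $A$ with $n$ steps can be algorithmically transformed into an $o\mathscr{F}$ proof of $A$ with $O(n)$ steps, and vice versa.
   Context: $\mathscr{F}$ is a fixed Frege system for classical propositional logic (connectives $\wedge,\vee,\supset,\neg$; finitely many axiom schemas; sole rule modus ponens), containing the schema $(A\supset C)\supset((B\supset C)\supset((A\vee B)\supset C))$. In both $d\mathscr{F}$ and $o\mathscr{F}$ each proof step is a sequent $\Gamma\Rightarrow A$ with $\Gamma$ a finite (possibly empty) set of formulas. Axioms: $\Rightarrow A$ for any instance $A$ of an axiom schema of $\mathscr{F}$, and $\{A\}\Rightarrow A$ for any formula $A$. Both have modus ponens: from $\Gamma_i\Rightarrow A$ and $\Gamma_j\Rightarrow A\supset B$ infer $\Gamma_i\cup\Gamma_j\Rightarrow B$. $d\mathscr{F}$ has in addition the general deduction rule: from $\Gamma\Rightarrow B$ infer $\Gamma\setminus\{A\}\Rightarrow A\supset B$. $o\mathscr{F}$ has instead the rule $\vee_e$: from $\Gamma_i\Rightarrow A\vee B$, $\Gamma_j\cup\{A\}\Rightarrow C$ and $\Gamma_k\cup\{B\}\Rightarrow C$ infer $(\Gamma_i\cup\Gamma_j\cup\Gamma_k)\setminus\{A,B\}\Rightarrow C$. A proof of $A$ is a finite sequence of sequents, each an axiom or obtained from earlier ones by a rule, ending in $\Rightarrow A$ (empty left side); the number of steps is the number of sequents.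
   Formalization: The rule ∨e is corrected to conclude Γ_i ∪ (Γ_j∖{A}) ∪ (Γ_k∖{B}) ⇒ C; as printed, with (Γ_i∪Γ_j∪Γ_k)∖{A,B}, it derives ⇒ A from {A} ⇒ A∨A and {A} ⇒ A for every A, so the disjunction system would be inconsistent and the simulation false. *)

theory Defs
  imports Main "HOL-Library.FSet" "HOL-Library.Nat_Bijection"
begin

subsection \<open>Frege systems for classical propositional logic\<close>

datatype form =
    Atom nat
  | Neg form
  | And form form
  | Or form form
  | Imp form form  (infixr "\<^bold>\<supset>" 60)

primrec eval :: "(nat \<Rightarrow> bool) \<Rightarrow> form \<Rightarrow> bool" where
  "eval v (Atom p) = v p"
| "eval v (Neg A) = (\<not> eval v A)"
| "eval v (And A B) = (eval v A \<and> eval v B)"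
| "eval v (Or A B) = (eval v A \<or> eval v B)"
| "eval v (A \<^bold>\<supset> B) = (eval v A \<longrightarrow> eval v B)"

definition tautology :: "form \<Rightarrow> bool" where
  "tautology A \<longleftrightarrow> (\<forall>v. eval v A)"

text \<open>An axiom schema is a formula whose atoms are read as metavariables; its instances are its
  substitution instances.\<close>

type_synonym schema = form

primrec subst :: "(nat \<Rightarrow> form) \<Rightarrow> schema \<Rightarrow> form" where
  "subst \<sigma> (Atom p) = \<sigma> p"
| "subst \<sigma> (Neg A) = Neg (subst \<sigma> A)"
| "subst \<sigma> (And A B) = And (subst \<sigma> A) (subst \<sigma> B)"
| "subst \<sigma> (Or A B) = Or (subst \<sigma> A) (subst \<sigma> B)"
| "subst \<sigma> (A \<^bold>\<supset> B) = (subst \<sigma> A \<^bold>\<supset> subst \<sigma> B)"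

definition axiom_instance :: "schema set \<Rightarrow> form \<Rightarrow> bool" where
  "axiom_instance F A \<longleftrightarrow> (\<exists>S\<in>F. \<exists>\<sigma>. A = subst \<sigma> S)"

inductive frege_provable :: "schema set \<Rightarrow> form \<Rightarrow> bool" for F where
  ax: "axiom_instance F A \<Longrightarrow> frege_provable F A"
| mp: "\<lbrakk>frege_provable F A; frege_provable F (A \<^bold>\<supset> B)\<rbrakk> \<Longrightarrow> frege_provable F B"

text \<open>Being a Frege system for classical propositional logic means being sound and complete for
  the two-valued semantics.\<close>

definition classical_frege_system :: "schema set \<Rightarrow> bool" where
  "classical_frege_system F \<longleftrightarrow>
     finite F \<and> (\<forall>A. frege_provable F A \<longleftrightarrow> tautology A)"

definition has_or_elim_schema :: "schema set \<Rightarrow> bool" where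
  "has_or_elim_schema F \<longleftrightarrow>
     (\<exists>a b c. distinct [a, b, c] \<and>
        ((Atom a \<^bold>\<supset> Atom c) \<^bold>\<supset> ((Atom b \<^bold>\<supset> Atom c) \<^bold>\<supset> (Or (Atom a) (Atom b) \<^bold>\<supset> Atom c))) \<in> F)"

subsection \<open>The general deduction and the general disjunction Frege system\<close>

datatype sequent = Sequent "form fset" form  (infix "\<^bold>\<turnstile>" 55)

text \<open>In the two step relations, the set P consists of the sequents derived earlier.\<close>

inductive dF_step :: "schema set \<Rightarrow> sequent set \<Rightarrow> sequent \<Rightarrow> bool" for F P where
  ax: "axiom_instance F A \<Longrightarrow> dF_step F P ({||} \<^bold>\<turnstile> A)"
| hyp: "dF_step F P ({|A|} \<^bold>\<turnstile> A)"
| mp: "\<lbrakk>(\<Gamma>i \<^bold>\<turnstile> A) \<in> P; (\<Gamma>j \<^bold>\<turnstile> A \<^bold>\<supset> B) \<in> P\<rbrakk> \<Longrightarrow> dF_step F P (\<Gamma>i |\<union>| \<Gamma>j \<^bold>\<turnstile> B)"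
| ded: "(\<Gamma> \<^bold>\<turnstile> B) \<in> P \<Longrightarrow> dF_step F P (\<Gamma> |-| {|A|} \<^bold>\<turnstile> A \<^bold>\<supset> B)"

text \<open>Disjunction elimination is often displayed with the antecedent
  \<open>(\<Gamma>i \<union> \<Gamma>j \<union> \<Gamma>k) - {A, B}\<close> in the conclusion. This must be read as discharging
  \<open>A\<close> in the second premise and \<open>B\<close> in the third one. Taken literally, it would also discharge
  occurrences that the disjunction does not justify: for every formula \<open>A\<close>, the sequents
  \<open>{A} \<Rightarrow> A \<or> A\<close>, \<open>{A} \<Rightarrow> A\<close> and \<open>{A} \<Rightarrow> A\<close> would yield \<open>{} \<Rightarrow> A\<close>, and the system would prove
  every formula. The two antecedents are equal unless \<open>A\<close> or \<open>B\<close> belongs to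
  \<open>\<Gamma>i \<union> (\<Gamma>j - {A}) \<union> (\<Gamma>k - {B})\<close>.\<close>

inductive oF_step :: "schema set \<Rightarrow> sequent set \<Rightarrow> sequent \<Rightarrow> bool" for F P where
  ax: "axiom_instance F A \<Longrightarrow> oF_step F P ({||} \<^bold>\<turnstile> A)"
| hyp: "oF_step F P ({|A|} \<^bold>\<turnstile> A)"
| mp: "\<lbrakk>(\<Gamma>i \<^bold>\<turnstile> A) \<in> P; (\<Gamma>j \<^bold>\<turnstile> A \<^bold>\<supset> B) \<in> P\<rbrakk> \<Longrightarrow> oF_step F P (\<Gamma>i |\<union>| \<Gamma>j \<^bold>\<turnstile> B)"
| or_elim: "\<lbrakk>(\<Gamma>i \<^bold>\<turnstile> Or A B) \<in> P; (\<Gamma>j |\<union>| {|A|} \<^bold>\<turnstile> C) \<in> P; (\<Gamma>k |\<union>| {|B|} \<^bold>\<turnstile> C) \<in> P\<rbrakk> \<Longrightarrow>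
     oF_step F P (\<Gamma>i |\<union>| (\<Gamma>j |-| {|A|}) |\<union>| (\<Gamma>k |-| {|B|}) \<^bold>\<turnstile> C)"

text \<open>The number of steps of a proof is the length of the list.\<close>

definition proof_of :: "(sequent set \<Rightarrow> sequent \<Rightarrow> bool) \<Rightarrow> sequent list \<Rightarrow> form \<Rightarrow> bool" where
  "proof_of step \<pi> A \<longleftrightarrow>
     (\<forall>i<length \<pi>. step (set (take i \<pi>)) (\<pi> ! i)) \<and> \<pi> \<noteq> [] \<and> last \<pi> = ({||} \<^bold>\<turnstile> A)"

abbreviation dF_proof :: "schema set \<Rightarrow> sequent list \<Rightarrow> form \<Rightarrow> bool" where
  "dF_proof F \<equiv> proof_of (dF_step F)"

abbreviation oF_proof :: "schema set \<Rightarrow> sequent list \<Rightarrow> form \<Rightarrow> bool" where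
  "oF_proof F \<equiv> proof_of (oF_step F)"

subsection \<open>Algorithmic transformations of proofs\<close>

text \<open>The total recursive functions in one argument, several arguments being passed through the
  Cantor pairing function: closure of the basic functions under composition, primitive recursion
  and minimisation of regular functions. By the Kleene normal form theorem, restricting
  minimisation to regular functions does not lose any total recursive function.\<close>

inductive total_recursive :: "(nat \<Rightarrow> nat) \<Rightarrow> bool" where
  zero: "total_recursive (\<lambda>x. 0)"
| suc: "total_recursive Suc"
| ident: "total_recursive (\<lambda>x. x)"
| proj1: "total_recursive (\<lambda>x. fst (prod_decode x))"
| proj2: "total_recursive (\<lambda>x. snd (prod_decode x))"
| pair: "\<lbrakk>total_recursive f; total_recursive g\<rbrakk> \<Longrightarrow> total_recursive (\<lambda>x. prod_encode (f x, g x))"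
| comp: "\<lbrakk>total_recursive f; total_recursive g\<rbrakk> \<Longrightarrow> total_recursive (\<lambda>x. f (g x))"
| prim_rec: "\<lbrakk>total_recursive f; total_recursive g\<rbrakk> \<Longrightarrow>
     total_recursive (\<lambda>z. let (x, n) = prod_decode z
       in rec_nat (f x) (\<lambda>m r. g (prod_encode (x, prod_encode (m, r)))) n)"
| minimise: "\<lbrakk>total_recursive f; \<forall>x. \<exists>y. f (prod_encode (x, y)) = 0\<rbrakk> \<Longrightarrow>
     total_recursive (\<lambda>x. LEAST y. f (prod_encode (x, y)) = 0)"

primrec form_code :: "form \<Rightarrow> nat" where
  "form_code (Atom p) = prod_encode (0, p)"
| "form_code (Neg A) = prod_encode (1, form_code A)"
| "form_code (And A B) = prod_encode (2, prod_encode (form_code A, form_code B))"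
| "form_code (Or A B) = prod_encode (3, prod_encode (form_code A, form_code B))"
| "form_code (A \<^bold>\<supset> B) = prod_encode (4, prod_encode (form_code A, form_code B))"

primrec sequent_code :: "sequent \<Rightarrow> nat" where
  "sequent_code (\<Gamma> \<^bold>\<turnstile> A) = prod_encode (set_encode (form_code ` fset \<Gamma>), form_code A)"

definition proof_code :: "sequent list \<Rightarrow> nat" where
  "proof_code \<pi> = list_encode (map sequent_code \<pi>)"

definition algorithmic_on :: "sequent list set \<Rightarrow> (sequent list \<Rightarrow> sequent list) \<Rightarrow> bool" where
  "algorithmic_on X T \<longleftrightarrow>
     (\<exists>f. total_recursive f \<and> (\<forall>\<pi>\<in>X. f (proof_code \<pi>) = proof_code (T \<pi>)))"

definition linearly_simulates ::
  "(sequent list \<Rightarrow> form \<Rightarrow> bool) \<Rightarrow> (sequent list \<Rightarrow> form \<Rightarrow> bool) \<Rightarrow> bool" where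
  "linearly_simulates Prf Prf' \<longleftrightarrow>
     (\<exists>T c. algorithmic_on {\<pi>. \<exists>A. Prf' \<pi> A} T \<and>
        (\<forall>\<pi> A. Prf' \<pi> A \<longrightarrow> Prf (T \<pi>) A \<and> length (T \<pi>) \<le> c * length \<pi>))"

end

theory Submission
  imports Defs
begin

text \<open>Each step is replaced by a block of boundedly many steps that ends in the same sequent. The
  conclusion \<open>\<Delta> \<Rightarrow> A \<supset> B\<close> of the deduction rule, where \<open>A \<notin> \<Delta>\<close>, comes from a premise \<open>\<Gamma> \<Rightarrow> B\<close> with
  \<open>\<Gamma>\<close> equal to \<open>\<Delta>\<close> or \<open>\<Delta> \<union> {A}\<close>. Modus ponens with \<open>{A} \<Rightarrow> B \<supset> (A \<supset> B)\<close> gives \<open>\<Delta> \<union> {A} \<Rightarrow> A \<supset> B\<close>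
  in both cases, and disjunction elimination on \<open>A \<or> \<not> A\<close> against \<open>{\<not> A} \<Rightarrow> A \<supset> B\<close> discharges \<open>A\<close>. The
  auxiliary tautologies have Frege proofs of constant length, as these are closed under substitution.
  Conversely, disjunction elimination is two deductions, the disjunction schema and three applications
  of modus ponens. The premises of a step are found by searching the earlier sequents, so the
  translation is recursive on codes.\<close>

section \<open>Closure properties of the total recursive functions\<close>

abbreviation p1 :: "nat \<Rightarrow> nat" where "p1 x \<equiv> fst (prod_decode x)"
abbreviation p2 :: "nat \<Rightarrow> nat" where "p2 x \<equiv> snd (prod_decode x)"

lemma total_recursive_const: "total_recursive (\<lambda>x. k)"
  by (induction k) (auto intro: total_recursive.zero comp[OF total_recursive.suc])

lemma total_recursive_Suc: "total_recursive f \<Longrightarrow> total_recursive (\<lambda>x. Suc (f x))"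
  by (rule comp[OF total_recursive.suc])

lemma total_recursive_fst: "total_recursive f \<Longrightarrow> total_recursive (\<lambda>x. p1 (f x))"
  by (rule comp[OF proj1])

lemma total_recursive_snd: "total_recursive f \<Longrightarrow> total_recursive (\<lambda>x. p2 (f x))"
  by (rule comp[OF proj2])

text \<open>\<open>prim_rec\<close> reads the recursion depth from its argument; composing it with
  the pairing of \<open>x\<close> and \<open>n x\<close> lets the depth depend on the parameter. In
  the step hypothesis \<open>w\<close> packs parameter, counter and previous value.\<close>

lemma total_recursive_rec_nat:
  assumes "total_recursive n" "total_recursive f"
    and "total_recursive (\<lambda>w. g (p1 w) (p1 (p2 w)) (p2 (p2 w)))"
  shows "total_recursive (\<lambda>x. rec_nat (f x) (g x) (n x))"
  using comp[OF prim_rec[OF assms(2,3)] pair[OF ident assms(1)]] by simp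

lemmas total_recursive_basics =
  total_recursive_const total_recursive_Suc total_recursive_fst total_recursive_snd ident pair

section \<open>Arithmetic, Boolean combinations and case distinction\<close>

lemma total_recursive_add:
  assumes "total_recursive f" "total_recursive g"
  shows "total_recursive (\<lambda>x. f x + g x)"
proof -
  have "rec_nat b (\<lambda>_ r. Suc r) a = a + b" for a b
    by (induction a) auto
  moreover have "total_recursive (\<lambda>w. Suc (p2 (p2 w)))"
    by (intro total_recursive_basics)
  ultimately show ?thesis
    using total_recursive_rec_nat[of f g "\<lambda>_ _ r. Suc r"] assms by simp
qed

lemma total_recursive_mult:
  assumes "total_recursive f" "total_recursive g"
  shows "total_recursive (\<lambda>x. f x * g x)"
proof -
  have "rec_nat 0 (\<lambda>_ r. b + r) a = a * b" for a b :: nat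
    by (induction a) auto
  moreover have "total_recursive (\<lambda>w. g (p1 w) + p2 (p2 w))"
    by (intro total_recursive_add comp[OF assms(2)] total_recursive_basics)
  ultimately show ?thesis
    using total_recursive_rec_nat[of f "\<lambda>_. 0" "\<lambda>x _ r. g x + r"] assms total_recursive.zero
    by simp
qed

lemma total_recursive_pred:
  assumes "total_recursive f"
  shows "total_recursive (\<lambda>x. f x - 1)"
proof -
  have "rec_nat 0 (\<lambda>m _. m) a = a - 1" for a :: nat
    by (cases a) auto
  moreover have "total_recursive (\<lambda>w. p1 (p2 w))"
    by (intro total_recursive_basics)
  ultimately show ?thesis
    using total_recursive_rec_nat[of f "\<lambda>_. 0" "\<lambda>_ m _. m"] assms total_recursive.zero
    by simp
qed

lemma total_recursive_diff:
  assumes "total_recursive f" "total_recursive g"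
  shows "total_recursive (\<lambda>x. f x - g x)"
proof -
  have "rec_nat a (\<lambda>_ r. r - 1) b = a - b" for a b :: nat
    by (induction b) auto
  moreover have "total_recursive (\<lambda>w. p2 (p2 w) - 1)"
    by (intro total_recursive_pred total_recursive_basics)
  ultimately show ?thesis
    using total_recursive_rec_nat[of g f "\<lambda>_ _ r. r - 1"] assms by simp
qed

lemma total_recursive_not:
  assumes "total_recursive (\<lambda>x. of_bool (P x))"
  shows "total_recursive (\<lambda>x. of_bool (\<not> P x))"
proof -
  have "total_recursive (\<lambda>x. 1 - of_bool (P x))"
    by (intro total_recursive_diff assms total_recursive_const)
  moreover have "(\<lambda>x. 1 - of_bool (P x) :: nat) = (\<lambda>x. of_bool (\<not> P x))"
    by auto
  ultimately show ?thesis by simp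
qed

lemma total_recursive_conj:
  assumes "total_recursive (\<lambda>x. of_bool (P x))" "total_recursive (\<lambda>x. of_bool (Q x))"
  shows "total_recursive (\<lambda>x. of_bool (P x \<and> Q x))"
  using total_recursive_mult[OF assms] by (simp add: of_bool_conj)

lemma total_recursive_disj:
  assumes "total_recursive (\<lambda>x. of_bool (P x))" "total_recursive (\<lambda>x. of_bool (Q x))"
  shows "total_recursive (\<lambda>x. of_bool (P x \<or> Q x))"
  using total_recursive_not[OF total_recursive_conj[OF assms[THEN total_recursive_not]]] by simp

lemma total_recursive_eq:
  assumes "total_recursive f" "total_recursive g"
  shows "total_recursive (\<lambda>x. of_bool (f x = g x))"
proof -
  \<comment> \<open>Subtraction is truncated, so both differences vanish exactly when the values
    agree.\<close>
  have "total_recursive (\<lambda>x. 1 - ((f x - g x) + (g x - f x)))"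
    by (intro total_recursive_diff total_recursive_add assms total_recursive_const)
  moreover have "(\<lambda>x. 1 - ((f x - g x) + (g x - f x))) = (\<lambda>x. of_bool (f x = g x))"
    by auto
  ultimately show ?thesis by simp
qed

lemma total_recursive_if:
  assumes "total_recursive (\<lambda>x. of_bool (P x))" "total_recursive f" "total_recursive g"
  shows "total_recursive (\<lambda>x. if P x then f x else g x)"
proof -
  have "total_recursive (\<lambda>x. of_bool (P x) * f x + of_bool (\<not> P x) * g x)"
    by (intro total_recursive_add total_recursive_mult total_recursive_not assms)
  moreover have "(\<lambda>x. of_bool (P x) * f x + of_bool (\<not> P x) * g x)
      = (\<lambda>x. if P x then f x else g x)"
    by auto
  ultimately show ?thesis by simp
qed

lemmas total_recursive_arith = total_recursive_basics total_recursive_add total_recursive_mult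
  total_recursive_diff total_recursive_not total_recursive_conj total_recursive_disj
  total_recursive_eq total_recursive_if

section \<open>Binary arithmetic and membership in coded sets\<close>

lemma total_recursive_power2:
  assumes "total_recursive f"
  shows "total_recursive (\<lambda>x. 2 ^ f x)"
proof -
  have "rec_nat 1 (\<lambda>_ r. 2 * r) n = (2::nat) ^ n" for n
    by (induction n) auto
  moreover have "total_recursive (\<lambda>w. 2 * p2 (p2 w))"
    by (intro total_recursive_arith)
  ultimately show ?thesis
    using total_recursive_rec_nat[of f "\<lambda>_. 1" "\<lambda>_ _ r. 2 * r"] assms total_recursive_const
    by simp
qed

lemma total_recursive_half:
  assumes "total_recursive f"
  shows "total_recursive (\<lambda>x. f x div 2)"
proof -
  \<comment> \<open>Passing from r to m - r turns floor(n/2) into n - floor(n/2) =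
    floor((n+1)/2).\<close>
  have "rec_nat 0 (\<lambda>m r. m - r) n = n div 2" for n :: nat
  proof (induction n)
    case (Suc n)
    have "n - n div 2 = Suc n div 2" by presburger
    then show ?case using Suc by simp
  qed simp
  moreover have "total_recursive (\<lambda>w. p1 (p2 w) - p2 (p2 w))"
    by (intro total_recursive_arith)
  ultimately show ?thesis
    using total_recursive_rec_nat[of f "\<lambda>_. 0" "\<lambda>_ m r. m - r"] assms total_recursive_const
    by simp
qed

text \<open>\<open>set_decode\<close> reads binary digits: halving \<open>g x\<close> exactly
  \<open>f x\<close> times brings the digit in question to the units place, where parity
  decides.\<close>

lemma total_recursive_mem_set_decode:
  assumes "total_recursive f" "total_recursive g"
  shows "total_recursive (\<lambda>x. of_bool (f x \<in> set_decode (g x)))"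
proof -
  define h where "h x = rec_nat (g x) (\<lambda>_ r. r div 2) (f x)" for x
  have "rec_nat b (\<lambda>_ r. r div 2) a = b div 2 ^ a" for a b :: nat
    by (induction a) (auto simp: div_mult2_eq[symmetric] mult.commute)
  then have h: "h x = g x div 2 ^ f x" for x
    by (simp add: h_def)
  have "total_recursive h"
    unfolding h_def
    by (intro total_recursive_rec_nat total_recursive_half total_recursive_basics assms)
  then have "total_recursive (\<lambda>x. of_bool (h x = 2 * (h x div 2) + 1))"
    by (intro total_recursive_half total_recursive_arith)
  moreover have "(h x = 2 * (h x div 2) + 1) = (f x \<in> set_decode (g x))" for x
    unfolding set_decode_def h[symmetric] mem_Collect_eq by presburger
  ultimately show ?thesis by simp
qed

section \<open>Folds and searches over coded lists\<close>

text \<open>Each \<open>Cons\<close> raises the code by at least one. A list code can thus serve as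
  the number of iterations when the list is traversed by primitive recursion.\<close>

lemma length_list_decode_le: "length (list_decode n) \<le> n"
proof -
  have "length xs \<le> list_encode xs" for xs
  proof (induction xs)
    case (Cons x xs)
    then show ?case using le_trans[OF _ le_prod_encode_2[of "list_encode xs" x]] by simp
  qed simp
  from this[of "list_decode n"] show ?thesis by simp
qed

lemma total_recursive_foldl:
  assumes "total_recursive i" "total_recursive l"
    and "total_recursive (\<lambda>w. g (p1 w) (p1 (p2 w)) (p2 (p2 w)))"
  shows "total_recursive (\<lambda>x. foldl (g x) (i x) (list_decode (l x)))"
proof -
  \<comment> \<open>The state pairs the accumulator with the code of the unread suffix. A nonempty
    list has code \<open>Suc (prod_encode (head, tail))\<close>, hence the subtraction of 1. On the
    empty suffix, with code 0, the state is stationary, so surplus iterations do no harm.\<close>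
  define st where "st x m r = (if p2 r = 0 then r
    else prod_encode (g x (p1 r) (p1 (p2 r - 1)), p2 (p2 r - 1)))" for x and m :: nat and r
  define it where "it x = rec_nat (prod_encode (i x, l x)) (st x) (l x)" for x
  have *: "rec_nat (prod_encode (a, list_encode xs)) (st x) n =
      prod_encode (foldl (g x) a (take n xs), list_encode (drop n xs))" for x a xs n
  proof (induction n)
    case (Suc n)
    show ?case
    proof (cases "n < length xs")
      case True
      then show ?thesis
        using Suc Cons_nth_drop_Suc[OF True, symmetric]
        by (simp add: st_def take_Suc_conv_app_nth)
    qed (use Suc in \<open>simp add: st_def\<close>)
  qed simp
  have "p1 (it x) = foldl (g x) (i x) (list_decode (l x))" for x
    using *[of "i x" "list_decode (l x)" x "l x"] length_list_decode_le[of "l x"]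
    by (simp add: it_def)
  moreover have "total_recursive (\<lambda>w. g (p1 w) (p1 (p2 (p2 w))) (p1 (p2 (p2 (p2 w)) - 1)))"
    using comp[OF assms(3), of "\<lambda>w. prod_encode (p1 w,
      prod_encode (p1 (p2 (p2 w)), p1 (p2 (p2 (p2 w)) - 1)))"]
    by (simp add: total_recursive_arith)
  then have "total_recursive it"
    unfolding it_def st_def
    by (intro total_recursive_rec_nat total_recursive_arith assms)
  ultimately show ?thesis
    using total_recursive_fst by force
qed

text \<open>A search that returns what it finds: 0 means failure, and hits are signalled by nonzero
  values, later the codes of nonempty lists. As a fold it is covered by
  \<open>total_recursive_foldl\<close>.\<close>

definition first_nonzero :: "(nat \<Rightarrow> nat) \<Rightarrow> nat list \<Rightarrow> nat" where
  "first_nonzero h xs = foldl (\<lambda>a e. if a = 0 then h e else a) 0 xs"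

lemma first_nonzero_Nil: "first_nonzero h [] = 0"
  by (simp add: first_nonzero_def)

lemma first_nonzero_Cons:
  "first_nonzero h (x # xs) = (if h x = 0 then first_nonzero h xs else h x)"
proof -
  have "a \<noteq> 0 \<Longrightarrow> foldl (\<lambda>a e. if a = 0 then h e else a) a xs = a" for a
    by (induction xs) auto
  then show ?thesis by (simp add: first_nonzero_def)
qed

lemma first_nonzero_eq_0_iff: "first_nonzero h xs = 0 \<longleftrightarrow> (\<forall>x\<in>set xs. h x = 0)"
  by (induction xs) (auto simp: first_nonzero_Cons first_nonzero_Nil)

lemma first_nonzero_neq_0E:
  assumes "first_nonzero h xs \<noteq> 0"
  obtains x where "x \<in> set xs" "h x \<noteq> 0" "first_nonzero h xs = h x"
proof -
  have "\<exists>x\<in>set xs. h x \<noteq> 0 \<and> first_nonzero h xs = h x"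
    using assms
    by (induction xs) (auto simp: first_nonzero_Cons first_nonzero_Nil split: if_splits)
  then show thesis using that by blast
qed

lemma total_recursive_first_nonzero:
  assumes "total_recursive l" "total_recursive (\<lambda>w. h (p1 w) (p2 w))"
  shows "total_recursive (\<lambda>x. first_nonzero (h x) (list_decode (l x)))"
proof -
  have "total_recursive (\<lambda>w. h (p1 w) (p2 (p2 w)))"
    using comp[OF assms(2), of "\<lambda>w. prod_encode (p1 w, p2 (p2 w))"]
    by (simp add: total_recursive_basics)
  then show ?thesis
    unfolding first_nonzero_def by (intro total_recursive_foldl total_recursive_arith assms(1))
qed

section \<open>Unions of coded sets, and codes of explicitly given lists\<close>

definition union_code :: "nat \<Rightarrow> nat \<Rightarrow> nat" where
  "union_code a b = (\<Sum>i<a + b. if i \<in> set_decode a \<or> i \<in> set_decode b then 2 ^ i else 0)"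

text \<open>As \<open>i < 2 ^ i\<close>, every element lies below the code of its set, so the sum up
  to \<open>a + b\<close> misses no element of either set.\<close>

lemma union_code_set_encode:
  assumes "finite A" "finite B"
  shows "union_code (set_encode A) (set_encode B) = set_encode (A \<union> B)"
proof -
  have le: "i < set_encode C" if "i \<in> C" "finite C" for i C
  proof -
    have "2 ^ i \<le> set_encode C"
      unfolding set_encode_def by (rule member_le_sum) (use that in auto)
    then show ?thesis using less_exp[of i] by linarith
  qed
  have "A \<union> B \<subseteq> {..<set_encode A + set_encode B}"
    using le[OF _ assms(1)] le[OF _ assms(2)] by fastforce
  then have "{..<set_encode A + set_encode B} \<inter> {i. i \<in> A \<or> i \<in> B} = A \<union> B"
    by blast
  then show ?thesis
    using assms unfolding union_code_def
    by (simp add: sum.If_cases) (simp add: set_encode_def)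
qed

lemma total_recursive_union_code:
  assumes "total_recursive f" "total_recursive g"
  shows "total_recursive (\<lambda>x. union_code (f x) (g x))"
proof -
  have sum_eq: "(\<Sum>i<n. h i) = rec_nat 0 (\<lambda>m r. r + h m) n" for h :: "nat \<Rightarrow> nat" and n
    by (induction n) auto
  show ?thesis
    unfolding union_code_def sum_eq
    by (intro total_recursive_rec_nat total_recursive_arith total_recursive_mem_set_decode
        total_recursive_power2 comp[OF assms(1)] comp[OF assms(2)] assms)
qed

lemma total_recursive_list_encode_Cons:
  "\<lbrakk>total_recursive f; total_recursive (\<lambda>x. list_encode (g x))\<rbrakk> \<Longrightarrow>
    total_recursive (\<lambda>x. list_encode (f x # g x))"
  by (simp add: total_recursive_basics)

lemma total_recursive_list_encode_append:
  assumes "\<And>l. total_recursive (h l)" "total_recursive (\<lambda>x. list_encode (g x))"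
  shows "total_recursive (\<lambda>x. list_encode (map (\<lambda>l. h l x) L @ g x))"
proof (induction L)
  case (Cons l L)
  then show ?case using assms(1)[of l] by (simp add: total_recursive_basics)
qed (simp add: assms)

section \<open>Blockwise translations\<close>

text \<open>The step condition relative to a stock \<open>P\<close> of available sequents, as
  required for a block inside a longer proof. It splits along concatenation.\<close>

fun derivs :: "(sequent set \<Rightarrow> sequent \<Rightarrow> bool) \<Rightarrow> sequent set \<Rightarrow> sequent list \<Rightarrow> bool" where
  "derivs step P [] \<longleftrightarrow> True"
| "derivs step P (s # ss) \<longleftrightarrow> step P s \<and> derivs step (insert s P) ss"

lemma derivs_append:
  "derivs step P (xs @ ys) \<longleftrightarrow> derivs step P xs \<and> derivs step (P \<union> set xs) ys"
  by (induction xs arbitrary: P) auto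

lemma derivs_iff_nth:
  "derivs step {} xs \<longleftrightarrow> (\<forall>i<length xs. step (set (take i xs)) (xs ! i))"
  by (induction xs rule: rev_induct) (auto simp: derivs_append nth_append less_Suc_eq)

lemma proof_of_iff_derivs:
  "proof_of step \<pi> A \<longleftrightarrow> derivs step {} \<pi> \<and> \<pi> \<noteq> [] \<and> last \<pi> = ({||} \<^bold>\<turnstile> A)"
  by (simp add: proof_of_def derivs_iff_nth)

text \<open>List codes grow at the front, so the fold pushes the elements of the first list in
  reverse. With 0, the code of \<open>[]\<close>, as second argument it is plain reversal.\<close>

definition rev_append_code :: "nat \<Rightarrow> nat \<Rightarrow> nat" where
  "rev_append_code a b = foldl (\<lambda>r e. Suc (prod_encode (e, r))) b (list_decode a)"

lemma rev_append_code_list_encode: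
  "rev_append_code (list_encode xs) (list_encode ys) = list_encode (rev xs @ ys)"
proof (induction xs arbitrary: ys)
  case (Cons x xs)
  from Cons[of "x # ys"] show ?case by (simp add: rev_append_code_def)
qed (simp add: rev_append_code_def)

lemma total_recursive_rev_append_code:
  assumes "total_recursive f" "total_recursive g"
  shows "total_recursive (\<lambda>x. rev_append_code (f x) (g x))"
  unfolding rev_append_code_def by (intro total_recursive_foldl total_recursive_basics assms)

text \<open>The state of the translation is a pair: the sequents read so far and the sequents written so
  far, both in reverse order.\<close>

definition translate_step :: "(nat \<Rightarrow> nat \<Rightarrow> nat) \<Rightarrow> nat \<Rightarrow> nat \<Rightarrow> nat" where
  "translate_step B z s =
     prod_encode (Suc (prod_encode (s, p1 z)), rev_append_code (B s (p1 z)) (p2 z))"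

lemma translate_step_prod_encode:
  "translate_step B (prod_encode (a, b)) s =
     prod_encode (Suc (prod_encode (s, a)), rev_append_code (B s a) b)"
  by (simp add: translate_step_def)

definition translate :: "(nat \<Rightarrow> nat \<Rightarrow> nat) \<Rightarrow> nat \<Rightarrow> nat" where
  "translate B x =
     rev_append_code (p2 (foldl (translate_step B) (prod_encode (0, 0)) (list_decode x))) 0"

lemma total_recursive_translate:
  assumes "total_recursive (\<lambda>w. B (p1 w) (p2 w))"
  shows "total_recursive (translate B)"
proof -
  have "total_recursive (\<lambda>w. B (p2 (p2 w)) (p1 (p1 (p2 w))))"
    using comp[OF assms, of "\<lambda>w. prod_encode (p2 (p2 w), p1 (p1 (p2 w)))"]
    by (simp add: total_recursive_basics)
  then show ?thesis
    unfolding translate_def translate_step_def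
    by (intro total_recursive_foldl total_recursive_rev_append_code total_recursive_basics)
qed

text \<open>A block may draw on everything written before, which includes all earlier source
  sequents, since each block ends in the sequent it replaces. The hypothesis covers
  \<open>prev\<close> in any order, so storing the earlier sequents in reverse is harmless.\<close>

lemma linearly_simulates_blockwise:
  assumes rec: "total_recursive (\<lambda>w. B (p1 w) (p2 w))"
    and block: "\<And>prev s P. \<lbrakk>step (set prev) s; set prev \<subseteq> P\<rbrakk> \<Longrightarrow>
      \<exists>\<beta>. B (sequent_code s) (list_encode (map sequent_code prev)) = proof_code \<beta> \<and>
        length \<beta> \<le> c \<and> \<beta> \<noteq> [] \<and> last \<beta> = s \<and> derivs step' P \<beta>"
  shows "linearly_simulates (proof_of step') (proof_of step)"
proof -
  \<comment> \<open>Invariant of the fold; the inclusion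
    \<open>set \<pi> \<subseteq> set \<rho>\<close> keeps the premises available to later
    blocks.\<close>
  have *: "\<exists>\<rho>. foldl (translate_step B) (prod_encode (0, 0)) (map sequent_code \<pi>) =
        prod_encode (proof_code (rev \<pi>), proof_code (rev \<rho>)) \<and>
      derivs step' {} \<rho> \<and> set \<pi> \<subseteq> set \<rho> \<and> length \<rho> \<le> c * length \<pi> \<and>
      (\<pi> \<noteq> [] \<longrightarrow> \<rho> \<noteq> [] \<and> last \<rho> = last \<pi>)" if "derivs step {} \<pi>" for \<pi>
    using that
  proof (induction \<pi> rule: rev_induct)
    case Nil
    show ?case by (rule exI[of _ "[]"]) (simp add: proof_code_def)
  next
    case (snoc s \<pi>)
    then obtain \<rho> where \<rho>: "foldl (translate_step B) (prod_encode (0, 0)) (map sequent_code \<pi>) =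
          prod_encode (proof_code (rev \<pi>), proof_code (rev \<rho>))"
        "derivs step' {} \<rho>" "set \<pi> \<subseteq> set \<rho>" "length \<rho> \<le> c * length \<pi>"
      by (auto simp: derivs_append)
    have "step (set (rev \<pi>)) s" "set (rev \<pi>) \<subseteq> set \<rho>"
      using snoc.prems \<rho>(3) by (auto simp: derivs_append)
    from block[OF this] obtain \<beta> where
      \<beta>: "B (sequent_code s) (proof_code (rev \<pi>)) = proof_code \<beta>"
        "length \<beta> \<le> c" "\<beta> \<noteq> []" "last \<beta> = s" "derivs step' (set \<rho>) \<beta>"
      by (auto simp: proof_code_def)
    have "s \<in> set \<beta>" using \<beta>(3,4) last_in_set by blast
    then have "set \<pi> \<union> {s} \<subseteq> set \<rho> \<union> set \<beta>"
      using \<rho>(3) by blast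
    then show ?case
      using \<rho> \<beta> by (intro exI[of _ "\<rho> @ \<beta>"])
        (auto simp: derivs_append translate_step_prod_encode proof_code_def rev_append_code_list_encode
          rev_map)
  qed
  \<comment> \<open>\<open>translate\<close> acts on codes, whereas \<open>T\<close> must act on
    lists: a list is chosen that has the computed code and the properties from the
    invariant.\<close>
  define T where "T \<pi> = (SOME \<rho>. translate B (proof_code \<pi>) = proof_code \<rho> \<and>
      length \<rho> \<le> c * length \<pi> \<and> \<rho> \<noteq> [] \<and> last \<rho> = last \<pi> \<and> derivs step' {} \<rho>)" for \<pi>
  have T: "translate B (proof_code \<pi>) = proof_code (T \<pi>) \<and>
      length (T \<pi>) \<le> c * length \<pi> \<and> T \<pi> \<noteq> [] \<and> last (T \<pi>) = last \<pi> \<and> derivs step' {} (T \<pi>)"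
    if "proof_of step \<pi> A" for \<pi> A
  proof -
    have "derivs step {} \<pi>" "\<pi> \<noteq> []"
      using that by (auto simp: proof_of_iff_derivs)
    with *[of \<pi>] obtain \<rho> where \<rho>:
      "foldl (translate_step B) (prod_encode (0, 0)) (map sequent_code \<pi>) =
        prod_encode (proof_code (rev \<pi>), proof_code (rev \<rho>))"
      "derivs step' {} \<rho>" "length \<rho> \<le> c * length \<pi>" "\<rho> \<noteq> []" "last \<rho> = last \<pi>"
      by blast
    have "translate B (proof_code \<pi>) = proof_code \<rho>"
      using \<rho>(1) rev_append_code_list_encode[of _ "[]"]
      by (simp add: translate_def proof_code_def rev_map)
    with \<rho> have "\<exists>\<rho>. translate B (proof_code \<pi>) = proof_code \<rho> \<and>
      length \<rho> \<le> c * length \<pi> \<and> \<rho> \<noteq> [] \<and> last \<rho> = last \<pi> \<and> derivs step' {} \<rho>"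
      by blast
    from someI_ex[OF this] show ?thesis
      unfolding T_def .
  qed
  then have "algorithmic_on {\<pi>. \<exists>A. proof_of step \<pi> A} T"
    unfolding algorithmic_on_def using total_recursive_translate[OF rec] by blast
  moreover have "proof_of step' (T \<pi>) A \<and> length (T \<pi>) \<le> c * length \<pi>"
    if "proof_of step \<pi> A" for \<pi> A
    using T[OF that] that by (simp add: proof_of_iff_derivs)
  ultimately show ?thesis
    unfolding linearly_simulates_def by blast
qed

section \<open>Codes of formulas and antecedents\<close>

lemma form_code_inject: "form_code A = form_code B \<longleftrightarrow> A = B"
proof
  show "form_code A = form_code B \<Longrightarrow> A = B"
  proof (induction A arbitrary: B)
    case (Atom p) then show ?case by (cases B) auto
  next
    case (Neg A) then show ?case by (cases B) auto
  next
    case (And A1 A2) then show ?case by (cases B) auto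
  next
    case (Or A1 A2) then show ?case by (cases B) auto
  next
    case (Imp A1 A2) then show ?case by (cases B) auto
  qed
qed simp

lemma form_code_tag_Or: "p1 (form_code A) = 3 \<Longrightarrow> \<exists>B C. A = Or B C"
  by (cases A) auto

lemma form_code_tag_Imp: "p1 (form_code A) = 4 \<Longrightarrow> \<exists>B C. A = (B \<^bold>\<supset> C)"
  by (cases A) auto

definition antecedent_code :: "form fset \<Rightarrow> nat" where
  "antecedent_code \<Gamma> = set_encode (form_code ` fset \<Gamma>)"

lemma sequent_code_eq: "sequent_code (\<Gamma> \<^bold>\<turnstile> A) = prod_encode (antecedent_code \<Gamma>, form_code A)"
  by (simp add: antecedent_code_def)

lemma inj_form_code: "inj form_code"
  by (auto simp: inj_def form_code_inject)

lemma antecedent_code_inject: "antecedent_code \<Gamma> = antecedent_code \<Delta> \<longleftrightarrow> \<Gamma> = \<Delta>"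
  by (simp add: antecedent_code_def set_encode_eq inj_image_eq_iff[OF inj_form_code] fset_inject)

lemma mem_antecedent_code: "form_code A \<in> set_decode (antecedent_code \<Gamma>) \<longleftrightarrow> A |\<in>| \<Gamma>"
  by (auto simp: antecedent_code_def form_code_inject)

lemma antecedent_code_empty: "antecedent_code {||} = 0"
  by (simp add: antecedent_code_def)

lemma antecedent_code_finsert:
  "A |\<notin>| \<Gamma> \<Longrightarrow> antecedent_code (finsert A \<Gamma>) = antecedent_code \<Gamma> + 2 ^ form_code A"
  by (subst antecedent_code_def, simp, subst set_encode_insert)
    (auto simp: antecedent_code_def form_code_inject)

lemma antecedent_code_singleton: "antecedent_code {|A|} = 2 ^ form_code A"
  by (simp add: antecedent_code_finsert antecedent_code_empty)

lemma antecedent_code_remove: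
  assumes "A |\<in>| \<Gamma>"
  shows "antecedent_code (\<Gamma> |-| {|A|}) = antecedent_code \<Gamma> - 2 ^ form_code A"
proof -
  have "finsert A (\<Gamma> |-| {|A|}) = \<Gamma>" using assms by auto
  then show ?thesis
    using antecedent_code_finsert[of A "\<Gamma> |-| {|A|}"] by simp
qed

lemma antecedent_code_union:
  "antecedent_code (\<Gamma> |\<union>| \<Delta>) = union_code (antecedent_code \<Gamma>) (antecedent_code \<Delta>)"
  by (simp add: antecedent_code_def union_code_set_encode image_Un)

definition imp_code :: "nat \<Rightarrow> nat \<Rightarrow> nat" where
  "imp_code a b = prod_encode (4, prod_encode (a, b))"

lemma form_code_Imp: "form_code (A \<^bold>\<supset> B) = imp_code (form_code A) (form_code B)"
  by (simp add: imp_code_def)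

lemma total_recursive_imp_code:
  "\<lbrakk>total_recursive f; total_recursive g\<rbrakk> \<Longrightarrow> total_recursive (\<lambda>x. imp_code (f x) (g x))"
  unfolding imp_code_def by (intro total_recursive_basics)

text \<open>The recursion runs through a fixed schema, so for each \<open>S\<close> this is an
  explicit composition of pairings in the codes of the substituted formulas.\<close>

primrec subst_code :: "(nat \<Rightarrow> nat) \<Rightarrow> schema \<Rightarrow> nat" where
  "subst_code \<sigma> (Atom p) = \<sigma> p"
| "subst_code \<sigma> (Neg A) = prod_encode (1, subst_code \<sigma> A)"
| "subst_code \<sigma> (And A B) = prod_encode (2, prod_encode (subst_code \<sigma> A, subst_code \<sigma> B))"
| "subst_code \<sigma> (Or A B) = prod_encode (3, prod_encode (subst_code \<sigma> A, subst_code \<sigma> B))"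
| "subst_code \<sigma> (A \<^bold>\<supset> B) = prod_encode (4, prod_encode (subst_code \<sigma> A, subst_code \<sigma> B))"

lemma form_code_subst: "form_code (subst \<sigma> S) = subst_code (\<lambda>p. form_code (\<sigma> p)) S"
  by (induction S) auto

lemma total_recursive_subst_code:
  "(\<And>p. total_recursive (\<lambda>x. \<sigma> x p)) \<Longrightarrow> total_recursive (\<lambda>x. subst_code (\<sigma> x) S)"
  by (induction S) (auto intro!: total_recursive_basics)

lemmas total_recursive_intros = total_recursive_arith total_recursive_power2
  total_recursive_mem_set_decode total_recursive_union_code total_recursive_list_encode_Cons
  total_recursive_list_encode_append total_recursive_imp_code total_recursive_first_nonzero

section \<open>Simulation of the deduction rule\<close>

lemma subst_subst: "subst \<sigma> (subst \<tau> S) = subst (\<lambda>p. subst \<sigma> (\<tau> p)) S"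
  by (induction S) auto

lemma axiom_instance_subst: "axiom_instance F A \<Longrightarrow> axiom_instance F (subst \<sigma> A)"
  unfolding axiom_instance_def by (metis subst_subst)

text \<open>Axiom instances and modus ponens are stable under substitution, so one list
  \<open>L\<close> serves every \<open>\<sigma>\<close>: all instances of a provable schema cost the
  same number of steps.\<close>

lemma frege_provable_derivs:
  assumes "frege_provable F S"
  shows "\<exists>L. S \<in> set L \<and> (\<forall>\<sigma> P. derivs (oF_step F) P (map (\<lambda>l. {||} \<^bold>\<turnstile> subst \<sigma> l) L))"
  using assms
proof induction
  case (ax A)
  then show ?case
    by (intro exI[of _ "[A]"]) (auto intro: oF_step.ax axiom_instance_subst)
next
  case (mp A B)
  then obtain L1 L2 where L1: "A \<in> set L1"
      "\<forall>\<sigma> P. derivs (oF_step F) P (map (\<lambda>l. {||} \<^bold>\<turnstile> subst \<sigma> l) L1)"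
    and L2: "(A \<^bold>\<supset> B) \<in> set L2"
      "\<forall>\<sigma> P. derivs (oF_step F) P (map (\<lambda>l. {||} \<^bold>\<turnstile> subst \<sigma> l) L2)"
    by blast
  have "derivs (oF_step F) P (map (\<lambda>l. {||} \<^bold>\<turnstile> subst \<sigma> l) (L1 @ L2 @ [B]))" for \<sigma> P
  proof -
    define Q where "Q = P \<union> (\<lambda>l. {||} \<^bold>\<turnstile> subst \<sigma> l) ` set L1 \<union> (\<lambda>l. {||} \<^bold>\<turnstile> subst \<sigma> l) ` set L2"
    have "({||} \<^bold>\<turnstile> subst \<sigma> A) \<in> Q" "({||} \<^bold>\<turnstile> subst \<sigma> A \<^bold>\<supset> subst \<sigma> B) \<in> Q"
      using L1(1) L2(1) by (force simp: Q_def)+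
    then have "oF_step F Q ({||} \<^bold>\<turnstile> subst \<sigma> B)"
      using oF_step.mp[of "{||}" "subst \<sigma> A" Q "{||}"] by simp
    then show ?thesis
      using L1(2) L2(2) by (simp add: derivs_append Q_def)
  qed
  then show ?case
    by (intro exI[of _ "L1 @ L2 @ [B]"]) simp
qed

lemma frege_provable_derivs_list:
  assumes "\<forall>S\<in>set Ss. frege_provable F S"
  shows "\<exists>L. set Ss \<subseteq> set L \<and> (\<forall>\<sigma> P. derivs (oF_step F) P (map (\<lambda>l. {||} \<^bold>\<turnstile> subst \<sigma> l) L))"
  using assms
proof (induction Ss)
  case (Cons S Ss)
  then obtain L where
    "set Ss \<subseteq> set L" "\<forall>\<sigma> P. derivs (oF_step F) P (map (\<lambda>l. {||} \<^bold>\<turnstile> subst \<sigma> l) L)"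
    by auto
  moreover obtain L' where
    "S \<in> set L'" "\<forall>\<sigma> P. derivs (oF_step F) P (map (\<lambda>l. {||} \<^bold>\<turnstile> subst \<sigma> l) L')"
    using frege_provable_derivs[of F S] Cons.prems by auto
  ultimately show ?case
    by (intro exI[of _ "L' @ L"]) (auto simp: derivs_append)
qed (intro exI[of _ "[]"], simp)

text \<open>The first schema carries an additional premise \<open>Atom 0\<close>: modus ponens with
  the hypothesis \<open>A\<close> forces \<open>A\<close> into the antecedent, whether or not the
  premise of the deduction contained it. The others handle the case that \<open>A\<close> is
  false.\<close>

definition ded_schemas :: "schema list" where
  "ded_schemas = [Atom 0 \<^bold>\<supset> (Atom 1 \<^bold>\<supset> (Atom 0 \<^bold>\<supset> Atom 1)),
     Neg (Atom 0) \<^bold>\<supset> (Atom 0 \<^bold>\<supset> Atom 1), Or (Atom 0) (Neg (Atom 0))]"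

text \<open>The Frege proofs in \<open>L\<close> may contain further atoms; any value will do for
  these.\<close>

definition ded_subst :: "form \<Rightarrow> form \<Rightarrow> nat \<Rightarrow> form" where
  "ded_subst A B p = (if p = 0 then A else B)"

definition ded_block :: "schema list \<Rightarrow> form fset \<Rightarrow> form \<Rightarrow> form \<Rightarrow> sequent list" where
  "ded_block L \<Delta> A B = map (\<lambda>l. {||} \<^bold>\<turnstile> subst (ded_subst A B) l) L @
     [{|A|} \<^bold>\<turnstile> A, {|A|} \<^bold>\<turnstile> B \<^bold>\<supset> (A \<^bold>\<supset> B), finsert A \<Delta> \<^bold>\<turnstile> A \<^bold>\<supset> B,
      {|Neg A|} \<^bold>\<turnstile> Neg A, {|Neg A|} \<^bold>\<turnstile> A \<^bold>\<supset> B, \<Delta> \<^bold>\<turnstile> A \<^bold>\<supset> B]"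

lemma derivs_ded_block:
  assumes L: "set ded_schemas \<subseteq> set L"
      "\<forall>\<sigma> P. derivs (oF_step F) P (map (\<lambda>l. {||} \<^bold>\<turnstile> subst \<sigma> l) L)"
    and \<Gamma>: "(\<Gamma> \<^bold>\<turnstile> B) \<in> P" "\<Gamma> = \<Delta> \<or> \<Gamma> = finsert A \<Delta>" and A: "A |\<notin>| \<Delta>"
  shows "derivs (oF_step F) P (ded_block L \<Delta> A B)"
proof -
  define Q where "Q = P \<union> (\<lambda>l. {||} \<^bold>\<turnstile> subst (ded_subst A B) l) ` set L"
  have Q: "({||} \<^bold>\<turnstile> A \<^bold>\<supset> (B \<^bold>\<supset> (A \<^bold>\<supset> B))) \<in> Q" "({||} \<^bold>\<turnstile> Neg A \<^bold>\<supset> (A \<^bold>\<supset> B)) \<in> Q"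
    "({||} \<^bold>\<turnstile> Or A (Neg A)) \<in> Q" "(\<Gamma> \<^bold>\<turnstile> B) \<in> Q"
    using L(1) \<Gamma>(1) by (force simp: Q_def ded_schemas_def ded_subst_def)+
  \<comment> \<open>The stock of sequents grows along the block, hence the four inferences are
    stated for any \<open>R\<close> above \<open>Q\<close>.\<close>
  have 1: "oF_step F R ({|A|} \<^bold>\<turnstile> B \<^bold>\<supset> (A \<^bold>\<supset> B))" if "({|A|} \<^bold>\<turnstile> A) \<in> R" "Q \<subseteq> R" for R
    using oF_step.mp[of "{|A|}" A R "{||}"] that Q by auto
  have 2: "oF_step F R (finsert A \<Delta> \<^bold>\<turnstile> A \<^bold>\<supset> B)"
    if "({|A|} \<^bold>\<turnstile> B \<^bold>\<supset> (A \<^bold>\<supset> B)) \<in> R" "Q \<subseteq> R" for R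
  proof -
    have "\<Gamma> |\<union>| {|A|} = finsert A \<Delta>" using \<Gamma>(2) by auto
    then show ?thesis
      using oF_step.mp[of \<Gamma> B R "{|A|}" "A \<^bold>\<supset> B" F] that Q by auto
  qed
  have 3: "oF_step F R ({|Neg A|} \<^bold>\<turnstile> A \<^bold>\<supset> B)" if "({|Neg A|} \<^bold>\<turnstile> Neg A) \<in> R" "Q \<subseteq> R" for R
    using oF_step.mp[of "{|Neg A|}" "Neg A" R "{||}"] that Q by auto
  have 4: "oF_step F R (\<Delta> \<^bold>\<turnstile> A \<^bold>\<supset> B)"
    if "(finsert A \<Delta> \<^bold>\<turnstile> A \<^bold>\<supset> B) \<in> R" "({|Neg A|} \<^bold>\<turnstile> A \<^bold>\<supset> B) \<in> R" "Q \<subseteq> R" for R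
    using oF_step.or_elim[of "{||}" A "Neg A" R \<Delta> "A \<^bold>\<supset> B" "{||}"] that Q A by auto
  show ?thesis
    using L(2) unfolding ded_block_def derivs_append
    by (auto simp: Q_def[symmetric] intro!: oF_step.hyp 1 2 3 4)
qed

text \<open>0 codes the empty antecedent and \<open>prod_encode (1, a)\<close> the negation.
  \<open>\<Delta> + 2 ^ a\<close> codes an insertion only when \<open>a\<close> is absent from
  \<open>\<Delta>\<close>.\<close>

definition ded_block_code :: "schema list \<Rightarrow> nat \<Rightarrow> nat \<Rightarrow> nat \<Rightarrow> nat" where
  "ded_block_code L \<Delta> a b = list_encode
     (map (\<lambda>l. prod_encode (0, subst_code (\<lambda>p. if p = 0 then a else b) l)) L @
      [prod_encode (2 ^ a, a), prod_encode (2 ^ a, imp_code b (imp_code a b)),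
       prod_encode (\<Delta> + 2 ^ a, imp_code a b), prod_encode (2 ^ prod_encode (1, a), prod_encode (1, a)),
       prod_encode (2 ^ prod_encode (1, a), imp_code a b), prod_encode (\<Delta>, imp_code a b)])"

lemma proof_code_ded_block:
  assumes "A |\<notin>| \<Delta>"
  shows "proof_code (ded_block L \<Delta> A B) =
    ded_block_code L (antecedent_code \<Delta>) (form_code A) (form_code B)"
proof -
  have "(\<lambda>p. form_code (ded_subst A B p)) = (\<lambda>p. if p = 0 then form_code A else form_code B)"
    by (auto simp: ded_subst_def)
  then show ?thesis
    using assms
    by (simp add: proof_code_def ded_block_def ded_block_code_def sequent_code_eq form_code_Imp
        antecedent_code_empty antecedent_code_singleton antecedent_code_finsert form_code_subst comp_def
        del: list_encode.simps sequent_code.simps form_code.simps(5))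
qed

text \<open>Whether a step is an instance of the deduction rule is decided by looking for its premise among
  the earlier sequents. As the block of such an instance is correct however the step was obtained, no
  other rule has to be recognised.\<close>

definition ded_translation :: "schema list \<Rightarrow> nat \<Rightarrow> nat \<Rightarrow> nat" where
  "ded_translation L s prev =
     (let \<Delta> = p1 s; a = p1 (p2 (p2 s)); b = p2 (p2 (p2 s));
       v = first_nonzero (\<lambda>p. if p1 (p2 s) = 4 \<and> a \<notin> set_decode \<Delta> \<and> p2 p = b \<and>
             (p1 p = \<Delta> \<or> p1 p = \<Delta> + 2 ^ a) then ded_block_code L \<Delta> a b else 0) (list_decode prev)
      in if v = 0 then list_encode [s] else v)"

lemma total_recursive_ded_translation: "total_recursive (\<lambda>w. ded_translation L (p1 w) (p2 w))"
  unfolding ded_translation_def Let_def ded_block_code_def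
  by (intro total_recursive_intros total_recursive_subst_code)

text \<open>Ensures that a block is not mistaken for the failure value 0 of the search.\<close>

lemma ded_block_code_nonzero: "ded_block_code L \<Delta> a b \<noteq> 0"
  by (cases L) (auto simp: ded_block_code_def)

text \<open>If the search fails, the step cannot be a deduction, as the premise would have been
  found; it then stems from a rule common to both systems and is copied. The bound counts
  \<open>L\<close> and six further sequents.\<close>

lemma ded_translation_correct:
  assumes L: "set ded_schemas \<subseteq> set L"
      "\<forall>\<sigma> P. derivs (oF_step F) P (map (\<lambda>l. {||} \<^bold>\<turnstile> subst \<sigma> l) L)"
    and step: "dF_step F (set prev) s" and P: "set prev \<subseteq> P"
  shows "\<exists>\<beta>. ded_translation L (sequent_code s) (list_encode (map sequent_code prev)) =
      proof_code \<beta> \<and> length \<beta> \<le> length L + 6 \<and> \<beta> \<noteq> [] \<and> last \<beta> = s \<and> derivs (oF_step F) P \<beta>"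
proof -
  obtain \<Delta> D where s: "s = (\<Delta> \<^bold>\<turnstile> D)" by (cases s)
  define h where "h p = (if p1 (p2 (sequent_code s)) = 4 \<and>
      p1 (p2 (p2 (sequent_code s))) \<notin> set_decode (p1 (sequent_code s)) \<and>
      p2 p = p2 (p2 (p2 (sequent_code s))) \<and>
      (p1 p = p1 (sequent_code s) \<or>
       p1 p = p1 (sequent_code s) + 2 ^ p1 (p2 (p2 (sequent_code s))))
    then ded_block_code L (p1 (sequent_code s)) (p1 (p2 (p2 (sequent_code s))))
      (p2 (p2 (p2 (sequent_code s)))) else 0)" for p
  define v where "v = first_nonzero h (map sequent_code prev)"
  have tr: "ded_translation L (sequent_code s) (list_encode (map sequent_code prev)) =
      (if v = 0 then list_encode [sequent_code s] else v)"
    by (simp add: ded_translation_def Let_def v_def h_def[abs_def])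
  have h_Imp: "h (sequent_code (\<Gamma> \<^bold>\<turnstile> C)) =
      (if A |\<notin>| \<Delta> \<and> C = B \<and> (\<Gamma> = \<Delta> \<or> \<Gamma> = finsert A \<Delta>) then
        proof_code (ded_block L \<Delta> A B) else 0)" if "D = (A \<^bold>\<supset> B)" for A B \<Gamma> C
  proof (cases "A |\<in>| \<Delta>")
    case False
    then show ?thesis
      using that antecedent_code_finsert[OF False, symmetric]
      by (simp add: h_def s sequent_code_eq mem_antecedent_code antecedent_code_inject
          form_code_inject proof_code_ded_block del: sequent_code.simps) blast
  qed (use that in \<open>simp add: h_def s sequent_code_eq mem_antecedent_code del: sequent_code.simps\<close>)
  show ?thesis
  proof (cases "v = 0")
    case True
    have "oF_step F P s"
      using step
    proof cases
      case (ded \<Gamma> B A)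
      have "h (sequent_code (\<Gamma> \<^bold>\<turnstile> B)) = 0"
        using True ded(2) by (auto simp: v_def first_nonzero_eq_0_iff)
      \<comment> \<open>Removing \<open>A\<close> from \<open>\<Gamma>\<close> gives
        \<open>\<Delta>\<close>, so these are the only two shapes that the search has to
        try.\<close>
      moreover have "\<Gamma> = \<Delta> \<or> \<Gamma> = finsert A \<Delta>" "A |\<notin>| \<Delta>"
        using ded(1) s by auto
      moreover have "proof_code (ded_block L \<Delta> A B) \<noteq> 0"
        using \<open>A |\<notin>| \<Delta>\<close> by (simp add: proof_code_ded_block ded_block_code_nonzero)
      ultimately show ?thesis
        using h_Imp[of A B \<Gamma> B] ded(1) s by simp
    qed (use P in \<open>auto intro: oF_step.intros\<close>)
    then show ?thesis
      using True tr by (intro exI[of _ "[s]"]) (simp add: proof_code_def)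
  next
    case False
    obtain e where "e \<in> set (map sequent_code prev)" "h e \<noteq> 0" "v = h e"
      using False unfolding v_def by (rule first_nonzero_neq_0E)
    then obtain p where p: "p \<in> set prev" "h (sequent_code p) \<noteq> 0" "v = h (sequent_code p)"
      by auto
    obtain \<Gamma> C where pC: "p = (\<Gamma> \<^bold>\<turnstile> C)" by (cases p)
    have "p1 (form_code D) = 4"
      using p(2) by (auto simp: h_def s split: if_splits)
    then obtain A B where D: "D = (A \<^bold>\<supset> B)" using form_code_tag_Imp by blast
    have *: "A |\<notin>| \<Delta>" "C = B" "\<Gamma> = \<Delta> \<or> \<Gamma> = finsert A \<Delta>"
        "v = proof_code (ded_block L \<Delta> A B)"
      using p(2,3) h_Imp[OF D, of \<Gamma> C] by (simp_all add: pC split: if_splits)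
    have "derivs (oF_step F) P (ded_block L \<Delta> A B)"
      using derivs_ded_block[OF L _ *(3,1)] p(1) P pC *(2) by auto
    then show ?thesis
      using False tr *(4) by (intro exI[of _ "ded_block L \<Delta> A B"]) (simp add: ded_block_def s D)
  qed
qed

section \<open>Simulation of disjunction elimination\<close>

text \<open>\<open>\<Delta>\<close> and \<open>\<Theta>\<close> are meant as the antecedents after
  \<open>A\<close> and \<open>B\<close> have been discharged.\<close>

definition or_block ::
    "form fset \<Rightarrow> form fset \<Rightarrow> form fset \<Rightarrow> form \<Rightarrow> form \<Rightarrow> form \<Rightarrow> sequent list" where
  "or_block \<Gamma> \<Delta> \<Theta> A B C =
     [\<Delta> \<^bold>\<turnstile> A \<^bold>\<supset> C, \<Theta> \<^bold>\<turnstile> B \<^bold>\<supset> C,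
      {||} \<^bold>\<turnstile> (A \<^bold>\<supset> C) \<^bold>\<supset> ((B \<^bold>\<supset> C) \<^bold>\<supset> (Or A B \<^bold>\<supset> C)),
      \<Delta> \<^bold>\<turnstile> (B \<^bold>\<supset> C) \<^bold>\<supset> (Or A B \<^bold>\<supset> C), \<Delta> |\<union>| \<Theta> \<^bold>\<turnstile> Or A B \<^bold>\<supset> C,
      \<Gamma> |\<union>| (\<Delta> |\<union>| \<Theta>) \<^bold>\<turnstile> C]"

lemma axiom_instance_or_elim:
  assumes "has_or_elim_schema F"
  shows "axiom_instance F ((A \<^bold>\<supset> C) \<^bold>\<supset> ((B \<^bold>\<supset> C) \<^bold>\<supset> (Or A B \<^bold>\<supset> C)))"
proof -
  obtain a b c where abc: "distinct [a, b, c]" and in_F: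
    "((Atom a \<^bold>\<supset> Atom c) \<^bold>\<supset> ((Atom b \<^bold>\<supset> Atom c) \<^bold>\<supset> (Or (Atom a) (Atom b) \<^bold>\<supset> Atom c))) \<in> F"
    using assms unfolding has_or_elim_schema_def by blast
  show ?thesis
    unfolding axiom_instance_def
    by (rule bexI[OF _ in_F], rule exI[of _ "\<lambda>p. if p = a then A else if p = b then B else C"])
      (use abc in auto)
qed

lemma derivs_or_block:
  assumes F: "has_or_elim_schema F"
    and P: "(\<Gamma> \<^bold>\<turnstile> Or A B) \<in> P" "(\<Delta> \<^bold>\<turnstile> C) \<in> P" "(\<Theta> \<^bold>\<turnstile> C) \<in> P"
  shows "derivs (dF_step F) P (or_block \<Gamma> (\<Delta> |-| {|A|}) (\<Theta> |-| {|B|}) A B C)"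
proof -
  have mp: "dF_step F R (\<Gamma>1 |\<union>| \<Gamma>2 \<^bold>\<turnstile> Y)" if "(\<Gamma>1 \<^bold>\<turnstile> X) \<in> R" "(\<Gamma>2 \<^bold>\<turnstile> X \<^bold>\<supset> Y) \<in> R" for R \<Gamma>1 \<Gamma>2 X Y
    using that by (rule dF_step.mp)
  \<comment> \<open>Variants of modus ponens that match the antecedents in \<open>or_block\<close>
    syntactically: without the empty set, and with the union reversed.\<close>
  have mp0: "dF_step F R (\<Gamma>1 \<^bold>\<turnstile> Y)" if "(\<Gamma>1 \<^bold>\<turnstile> X) \<in> R" "({||} \<^bold>\<turnstile> X \<^bold>\<supset> Y) \<in> R" for R \<Gamma>1 X Y
    using mp[OF that] by simp
  have mp_swap: "dF_step F R (\<Gamma>2 |\<union>| \<Gamma>1 \<^bold>\<turnstile> Y)"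
    if "(\<Gamma>1 \<^bold>\<turnstile> X) \<in> R" "(\<Gamma>2 \<^bold>\<turnstile> X \<^bold>\<supset> Y) \<in> R" for R \<Gamma>1 \<Gamma>2 X Y
    using mp[OF that] by (simp add: sup_commute)
  show ?thesis
    unfolding or_block_def derivs.simps
    using P
    by (intro conjI TrueI dF_step.ded dF_step.ax axiom_instance_or_elim[OF F]
        mp0[where X = "A \<^bold>\<supset> C"] mp_swap[where X = "B \<^bold>\<supset> C"] mp[where X = "Or A B"]) simp_all
qed

definition or_block_code :: "nat \<Rightarrow> nat \<Rightarrow> nat \<Rightarrow> nat \<Rightarrow> nat \<Rightarrow> nat \<Rightarrow> nat" where
  "or_block_code x y z a b c = (let ab = prod_encode (3, prod_encode (a, b)) in list_encode
     [prod_encode (y, imp_code a c), prod_encode (z, imp_code b c),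
      prod_encode (0, imp_code (imp_code a c) (imp_code (imp_code b c) (imp_code ab c))),
      prod_encode (y, imp_code (imp_code b c) (imp_code ab c)),
      prod_encode (union_code y z, imp_code ab c),
      prod_encode (union_code x (union_code y z), c)])"

lemma proof_code_or_block:
  "proof_code (or_block \<Gamma> \<Delta> \<Theta> A B C) = or_block_code (antecedent_code \<Gamma>) (antecedent_code \<Delta>)
     (antecedent_code \<Theta>) (form_code A) (form_code B) (form_code C)"
  by (simp add: proof_code_def or_block_def or_block_code_def Let_def sequent_code_eq form_code_Imp
      antecedent_code_empty antecedent_code_union del: sequent_code.simps form_code.simps(5))

text \<open>Subtracting \<open>2 ^ a\<close> removes an element only if it is present. The
  membership tests that secure this exclude no instance of the rule, whose premises are displayed
  with \<open>A\<close> and \<open>B\<close> inserted.\<close>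

definition or_candidate :: "nat \<Rightarrow> nat \<Rightarrow> nat \<Rightarrow> nat \<Rightarrow> nat" where
  "or_candidate s p q r =
     (let a = p1 (p2 (p2 p)); b = p2 (p2 (p2 p)); y = p1 q - 2 ^ a; z = p1 r - 2 ^ b
      in if p1 (p2 p) = 3 \<and> p2 q = p2 s \<and> p2 r = p2 s \<and> a \<in> set_decode (p1 q) \<and>
          b \<in> set_decode (p1 r) \<and> p1 s = union_code (p1 p) (union_code y z)
         then or_block_code (p1 p) y z a b (p2 s) else 0)"

definition or_translation :: "nat \<Rightarrow> nat \<Rightarrow> nat" where
  "or_translation s prev =
     (let v = first_nonzero (\<lambda>p. first_nonzero (\<lambda>q. first_nonzero (\<lambda>r. or_candidate s p q r)
          (list_decode prev)) (list_decode prev)) (list_decode prev)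
      in if v = 0 then list_encode [s] else v)"

lemma total_recursive_or_translation: "total_recursive (\<lambda>w. or_translation (p1 w) (p2 w))"
  unfolding or_translation_def or_candidate_def or_block_code_def Let_def
  by (intro total_recursive_intros)

lemma or_candidate_Or:
  "or_candidate (sequent_code (\<Sigma> \<^bold>\<turnstile> C)) (sequent_code (\<Gamma> \<^bold>\<turnstile> Or A B))
      (sequent_code (\<Delta> \<^bold>\<turnstile> D)) (sequent_code (\<Theta> \<^bold>\<turnstile> E)) =
    (if D = C \<and> E = C \<and> A |\<in>| \<Delta> \<and> B |\<in>| \<Theta> \<and>
        \<Sigma> = \<Gamma> |\<union>| ((\<Delta> |-| {|A|}) |\<union>| (\<Theta> |-| {|B|}))
     then proof_code (or_block \<Gamma> (\<Delta> |-| {|A|}) (\<Theta> |-| {|B|}) A B C) else 0)"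
proof (cases "A |\<in>| \<Delta> \<and> B |\<in>| \<Theta>")
  case True
  then show ?thesis
    by (simp add: or_candidate_def Let_def sequent_code_eq mem_antecedent_code form_code_inject
        proof_code_or_block antecedent_code_remove[symmetric] antecedent_code_union[symmetric]
        antecedent_code_inject del: sequent_code.simps)
qed (auto simp: or_candidate_def Let_def sequent_code_eq mem_antecedent_code simp del: sequent_code.simps)

text \<open>As for deduction, a failed search excludes disjunction elimination, and every other rule
  is shared by both systems.\<close>

lemma or_translation_correct:
  assumes F: "has_or_elim_schema F" and step: "oF_step F (set prev) s" and P: "set prev \<subseteq> P"
  shows "\<exists>\<beta>. or_translation (sequent_code s) (list_encode (map sequent_code prev)) =
      proof_code \<beta> \<and> length \<beta> \<le> 6 \<and> \<beta> \<noteq> [] \<and> last \<beta> = s \<and> derivs (dF_step F) P \<beta>"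
proof -
  obtain \<Sigma> C where s: "s = (\<Sigma> \<^bold>\<turnstile> C)" by (cases s)
  define xs where "xs = map sequent_code prev"
  define v where "v = first_nonzero (\<lambda>p. first_nonzero (\<lambda>q. first_nonzero (\<lambda>r.
    or_candidate (sequent_code s) p q r) xs) xs) xs"
  have tr: "or_translation (sequent_code s) (list_encode (map sequent_code prev)) =
      (if v = 0 then list_encode [sequent_code s] else v)"
    by (simp add: or_translation_def Let_def v_def xs_def)
  show ?thesis
  proof (cases "v = 0")
    case True
    then have no_candidate:
      "or_candidate (sequent_code s) (sequent_code p) (sequent_code q) (sequent_code r) = 0"
      if "p \<in> set prev" "q \<in> set prev" "r \<in> set prev" for p q r
      using that by (auto simp: v_def xs_def first_nonzero_eq_0_iff)
    have "dF_step F P s"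
      using step
    proof cases
      case (or_elim \<Gamma> A B \<Delta> D \<Theta>)
      have "\<Sigma> = \<Gamma> |\<union>| (((\<Delta> |\<union>| {|A|}) |-| {|A|}) |\<union>| ((\<Theta> |\<union>| {|B|}) |-| {|B|}))" "D = C"
        using or_elim(1) s by auto
      then have "proof_code (or_block \<Gamma> ((\<Delta> |\<union>| {|A|}) |-| {|A|}) ((\<Theta> |\<union>| {|B|}) |-| {|B|}) A B C) = 0"
        using no_candidate[OF or_elim(2-4)] unfolding s or_candidate_Or by simp
      \<comment> \<open>The block is nonempty, so its code cannot be 0: a contradiction.\<close>
      then show ?thesis by (simp add: proof_code_def or_block_def)
    qed (use P in \<open>auto intro: dF_step.intros\<close>)
    then show ?thesis
      using True tr by (intro exI[of _ "[s]"]) (simp add: proof_code_def)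
  next
    case False
    obtain p where p: "p \<in> set xs" "first_nonzero (\<lambda>q. first_nonzero (\<lambda>r.
        or_candidate (sequent_code s) p q r) xs) xs \<noteq> 0" "v = first_nonzero (\<lambda>q. first_nonzero (\<lambda>r.
        or_candidate (sequent_code s) p q r) xs) xs"
      using False unfolding v_def by (rule first_nonzero_neq_0E)
    obtain q where q: "q \<in> set xs" "first_nonzero (\<lambda>r. or_candidate (sequent_code s) p q r) xs \<noteq> 0"
        "v = first_nonzero (\<lambda>r. or_candidate (sequent_code s) p q r) xs"
      using p(2) unfolding p(3) by (rule first_nonzero_neq_0E)
    obtain r where r: "r \<in> set xs" "or_candidate (sequent_code s) p q r \<noteq> 0"
        "v = or_candidate (sequent_code s) p q r"
      using q(2) unfolding q(3) by (rule first_nonzero_neq_0E)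
    have in_P: "\<exists>\<Gamma> X. x = sequent_code (\<Gamma> \<^bold>\<turnstile> X) \<and> (\<Gamma> \<^bold>\<turnstile> X) \<in> P" if "x \<in> set xs" for x
      using that P unfolding xs_def set_map by (metis imageE sequent.exhaust subsetD)
    obtain \<Gamma> X \<Delta> D \<Theta> E where pqr: "p = sequent_code (\<Gamma> \<^bold>\<turnstile> X)" "(\<Gamma> \<^bold>\<turnstile> X) \<in> P"
        "q = sequent_code (\<Delta> \<^bold>\<turnstile> D)" "(\<Delta> \<^bold>\<turnstile> D) \<in> P" "r = sequent_code (\<Theta> \<^bold>\<turnstile> E)" "(\<Theta> \<^bold>\<turnstile> E) \<in> P"
      using in_P[OF p(1)] in_P[OF q(1)] in_P[OF r(1)] by blast
    have "p1 (form_code X) = 3"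
      using r(2) by (auto simp: or_candidate_def Let_def pqr split: if_splits)
    then obtain A B where X: "X = Or A B" using form_code_tag_Or by blast
    have *: "D = C" "E = C" "\<Sigma> = \<Gamma> |\<union>| ((\<Delta> |-| {|A|}) |\<union>| (\<Theta> |-| {|B|}))"
        "v = proof_code (or_block \<Gamma> (\<Delta> |-| {|A|}) (\<Theta> |-| {|B|}) A B C)"
      using r(2,3) unfolding pqr s X or_candidate_Or by (simp_all split: if_splits)
    have "derivs (dF_step F) P (or_block \<Gamma> (\<Delta> |-| {|A|}) (\<Theta> |-| {|B|}) A B C)"
      using derivs_or_block[OF F] pqr X * by blast
    then show ?thesis
      using False tr *(3,4)
      by (intro exI[of _ "or_block \<Gamma> (\<Delta> |-| {|A|}) (\<Theta> |-| {|B|}) A B C"]) (simp add: or_block_def s)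
  qed
qed

theorem theorem7:
  fixes F :: "schema set"
  assumes "classical_frege_system F" and "has_or_elim_schema F"
  shows "linearly_simulates (oF_proof F) (dF_proof F) \<and>
    linearly_simulates (dF_proof F) (oF_proof F)"
proof
  \<comment> \<open>Completeness of \<open>F\<close> provides Frege proofs of the three
    tautologies.\<close>
  have "\<forall>S\<in>set ded_schemas. frege_provable F S"
    using assms(1) by (auto simp: classical_frege_system_def tautology_def ded_schemas_def)
  from frege_provable_derivs_list[OF this] obtain L where L: "set ded_schemas \<subseteq> set L"
      "\<forall>\<sigma> P. derivs (oF_step F) P (map (\<lambda>l. {||} \<^bold>\<turnstile> subst \<sigma> l) L)"
    by blast
  \<comment> \<open>\<open>L\<close> was obtained from \<open>F\<close> before any proof is
    considered, so \<open>length L + 6\<close> is a legitimate constant.\<close>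
  show "linearly_simulates (oF_proof F) (dF_proof F)"
    by (rule linearly_simulates_blockwise[OF total_recursive_ded_translation
          ded_translation_correct[OF L]])
  show "linearly_simulates (dF_proof F) (oF_proof F)"
    by (rule linearly_simulates_blockwise[OF total_recursive_or_translation
          or_translation_correct[OF assms(2)]])
qed

end
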